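(* Consider a multi-layer feed-forward neural network with input $x\in\mathbb{R}^n$, $|x_i|<a$ for all $i$ and some a priori scalar $a\in(0,\infty)$, output $y\in\mathbb{R}^m$, target $y^*\in\mathbb{R}^m$, and loss $$E=\sum_{r=1}^m\frac{|y_r-y_r^*|^{\alpha+1}}{\alpha+1},\qquad \alpha\in(0,1).$$ Suppose that for each layer $l$, with $L$ units whose outputs $z_1,\dots,z_L$ are the inputs to layer $l+1$, at least one $z_i$ is non-zero, in the sense that $|z_p|>\gamma>0$ for some integer(s) $p\in[1,L]$, where $\gamma$ is an a priori known scalar. Let the weight update for the weight $w_{ji}$ connecting unit $i$ of layer $l$ to unit $j$ of layer $l+1$ be given by $$\dot w_{ji}=-k_{ji}\,\mathrm{sign}(\delta_j z_i)\,|\delta_j z_i|^{\alpha}\,E^{\beta},$$ with some scalar $\beta\in(0,1)$ such that $\alpha+\beta<1$, where $k_{ji}>0$ is a tuning parameter. Then the output vector $y$ converges to $y^*$ in finite time.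
   Context: Network: the layers are connected in a feed-forward manner. A unit $j$ of layer $l+1$ computes $a_j=\sum_i w_{ji}z_i$ from the outputs $z_i$ of the units of layer $l$ (the bias parameter is embedded in this linear combination), and its output is $z_j=\sigma(a_j)$, where $\sigma$ is a (differentiable) non-linear activation function. For the input layer, $z_i=x_i$; for the output layer, $z_r=y_r$, so $y_r=\sigma(a_r)$. Sensitivities: $\delta_j=\partial E/\partial a_j$, so that $\partial E/\partial w_{ji}=\delta_j z_i$. For an output unit $r$, $\delta_r=\sigma'(a_r)\,\partial E/\partial y_r$. For a hidden unit $j$, $\delta_j=\sigma'(a_j)\sum_k w_{kj}\delta_k$, where $k$ runs over the units of the next layer. Training is in continuous time $t\ge0$: all weights are functions of time evolving by the stated update, while $x$ and $y^*$ are held fixed in time. Here $\mathrm{sign}$ is the sign function. "Converges in finite time" means that there is a finite $T$ such that $y(t)=y^*$ for all $t\ge T$ along the resulting dynamics.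
   Formalization: Added assumption: for some constant c>0, |σ'(a_r(t))| ≥ c at all times t for every output unit r with y_r(t) ≠ y*_r. Without it the claim fails, e.g. for σ(u)=u³ with a_r=0, where all sensitivities vanish and the weights stay constant. *)

theory Defs
  imports "HOL-Analysis.Analysis"
begin

text \<open>
  A feed-forward network has layers \<open>0, \<dots>, N\<close>; layer \<open>l\<close> has the units \<open>1, \<dots>, d l\<close>, layer \<open>0\<close> being
  the input and layer \<open>N\<close> the output.  \<open>W l j i\<close> is the weight from unit \<open>i\<close> of layer \<open>l\<close> to unit \<open>j\<close>
  of layer \<open>l + 1\<close>.  The bias parameter of unit \<open>j\<close> is the weight \<open>W l j 0\<close>: index \<open>0\<close> of every
  layer stands for an additional unit with constant output \<open>b\<close> (\<open>b = 1\<close> is the usual convention;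
  \<open>b = 0\<close> gives a network without biases).  Values at other indices are irrelevant.
\<close>

type_synonym weights = "nat \<Rightarrow> nat \<Rightarrow> nat \<Rightarrow> real"

text \<open>The activations \<open>a\<^sub>j\<close> of layer \<open>l + 1\<close> as a function of the outputs \<open>z\<close> of layer \<open>l\<close>.\<close>

definition lin :: "(nat \<Rightarrow> nat) \<Rightarrow> weights \<Rightarrow> nat \<Rightarrow> (nat \<Rightarrow> real) \<Rightarrow> nat \<Rightarrow> real" where
  "lin d W l z j = (\<Sum>i=0..d l. W l j i * z i)"

definition unit_out :: "(real \<Rightarrow> real) \<Rightarrow> real \<Rightarrow> (nat \<Rightarrow> real) \<Rightarrow> nat \<Rightarrow> real" where
  "unit_out \<sigma> b a j = (if j = 0 then b else \<sigma> (a j))"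

text \<open>The outputs of layer \<open>l + r\<close> when the outputs of layer \<open>l\<close> are \<open>z\<close>.\<close>

primrec feed :: "(real \<Rightarrow> real) \<Rightarrow> real \<Rightarrow> (nat \<Rightarrow> nat) \<Rightarrow> weights \<Rightarrow> nat \<Rightarrow> nat
    \<Rightarrow> (nat \<Rightarrow> real) \<Rightarrow> nat \<Rightarrow> real" where
  "feed \<sigma> b d W l 0 z = z"
| "feed \<sigma> b d W l (Suc r) z = unit_out \<sigma> b (lin d W (l + r) (feed \<sigma> b d W l r z))"

definition layer_out :: "(real \<Rightarrow> real) \<Rightarrow> real \<Rightarrow> (nat \<Rightarrow> nat) \<Rightarrow> (nat \<Rightarrow> real) \<Rightarrow> weights
    \<Rightarrow> nat \<Rightarrow> nat \<Rightarrow> real" where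
  "layer_out \<sigma> b d x W l = feed \<sigma> b d W 0 l (x(0 := b))"

text \<open>Note the index: \<open>preact \<sigma> b d x W l j\<close> is the activation of unit \<open>j\<close> of layer \<open>l + 1\<close>.\<close>

definition preact :: "(real \<Rightarrow> real) \<Rightarrow> real \<Rightarrow> (nat \<Rightarrow> nat) \<Rightarrow> (nat \<Rightarrow> real) \<Rightarrow> weights
    \<Rightarrow> nat \<Rightarrow> nat \<Rightarrow> real" where
  "preact \<sigma> b d x W l = lin d W l (layer_out \<sigma> b d x W l)"

definition loss :: "real \<Rightarrow> nat \<Rightarrow> (nat \<Rightarrow> real) \<Rightarrow> (nat \<Rightarrow> real) \<Rightarrow> real" where
  "loss \<alpha> m ystar y = (\<Sum>r=1..m. \<bar>y r - ystar r\<bar> powr (\<alpha> + 1) / (\<alpha> + 1))"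

text \<open>
  The sensitivity \<open>\<delta>\<^sub>j = \<partial>E/\<partial>a\<^sub>j\<close> of unit \<open>j\<close> of layer \<open>l + 1\<close> (\<open>l < N\<close>): the activation of that unit
  is varied, those of the other units of the layer are kept, and the later layers are recomputed.
\<close>

definition sensitivity :: "(real \<Rightarrow> real) \<Rightarrow> real \<Rightarrow> (nat \<Rightarrow> nat) \<Rightarrow> nat \<Rightarrow> real \<Rightarrow> (nat \<Rightarrow> real)
    \<Rightarrow> (nat \<Rightarrow> real) \<Rightarrow> weights \<Rightarrow> nat \<Rightarrow> nat \<Rightarrow> real" where
  "sensitivity \<sigma> b d N \<alpha> ystar x W l j =
     deriv (\<lambda>s. loss \<alpha> (d N) ystar
                  (feed \<sigma> b d W (Suc l) (N - Suc l) (unit_out \<sigma> b ((preact \<sigma> b d x W l)(j := s)))))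
       (preact \<sigma> b d x W l j)"

end

theory Submission
  imports Defs
begin

text \<open>Backpropagation turns the chain rule into \<open>E' = - \<Sum> k\<^sub>j\<^sub>i |\<delta>\<^sub>j z\<^sub>i| powr (\<alpha> + 1) * E powr \<beta>\<close>.
  Every summand is nonpositive, so only one weight into the output layer has to be retained: for the
  output \<open>r\<close> with the largest error, \<open>E \<le> m |y\<^sub>r - y\<^sup>*\<^sub>r| powr (\<alpha> + 1)\<close> and
  \<open>|\<delta>\<^sub>r z\<^sub>p| \<ge> c \<gamma> |y\<^sub>r - y\<^sup>*\<^sub>r| powr \<alpha>\<close>, whence \<open>E' \<le> - K * E powr (\<alpha> + \<beta>)\<close>.  As \<open>\<alpha> + \<beta> < 1\<close>, the
  power \<open>E powr (1 - \<alpha> - \<beta>)\<close> decreases at least linearly while \<open>E > 0\<close>, so \<open>E\<close> vanishes in finite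
  time, and it stays zero because it is nonincreasing.\<close>

section \<open>Scalar calculus: powers of the modulus and a differential inequality\<close>

text \<open>At 0 the difference quotient is \<open>sgn h * (\<bar>h\<bar> powr p / (p + 1))\<close>,
  which tends to 0 because \<open>p > 0\<close>; negative arguments follow by reflection. Covering 0
  lets the loss be differentiated even at times when an output meets its target.\<close>

lemma abs_powr_has_real_derivative:
  fixes p u :: real
  assumes "0 < p"
  shows "((\<lambda>u. \<bar>u\<bar> powr (p + 1) / (p + 1)) has_real_derivative sgn u * \<bar>u\<bar> powr p) (at u within S)"
proof -
  have pos: "((\<lambda>u. \<bar>u\<bar> powr (p + 1) / (p + 1)) has_real_derivative v powr p) (at v)" if "0 < v" for v :: real
  proof -
    have "((\<lambda>u. u powr (p + 1) / (p + 1)) has_real_derivative v powr p) (at v)"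
      using DERIV_cdivide[OF DERIV_powr[OF DERIV_ident that DERIV_const, of "p + 1"], of "p + 1"] assms that
      by (simp add: powr_add)
    then show ?thesis
      by (rule has_field_derivative_transform_within_open[where S = "{0<..}"]) (use that in auto)
  qed
  show ?thesis
  proof (rule has_field_derivative_at_within, cases u "0 :: real" rule: linorder_cases)
    case equal
    have "((\<lambda>h::real. \<bar>h\<bar> powr p) \<longlongrightarrow> \<bar>0\<bar> powr p) (at 0)"
      by (rule tendsto_powr'[OF tendsto_rabs[OF tendsto_ident_at] tendsto_const]) (use assms in simp)
    then have lim: "((\<lambda>h::real. \<bar>h\<bar> powr p) \<longlongrightarrow> 0) (at 0)"
      by simp
    have "((\<lambda>h::real. sgn h * (\<bar>h\<bar> powr p / (p + 1))) \<longlongrightarrow> 0) (at 0)"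
      by (rule tendsto_0_le[OF lim, where K = "1 / (p + 1)"])
         (use assms in \<open>simp add: abs_mult abs_sgn_eq\<close>)
    moreover have "\<bar>h\<bar> powr (p + 1) / (p + 1) / h = sgn h * (\<bar>h\<bar> powr p / (p + 1))" for h :: real
      by (cases h "0 :: real" rule: linorder_cases) (simp_all add: powr_add)
    ultimately show "((\<lambda>u. \<bar>u\<bar> powr (p + 1) / (p + 1)) has_real_derivative sgn u * \<bar>u\<bar> powr p) (at u)"
      using equal assms by (simp add: has_field_derivative_iff)
  next
    case greater
    then show "((\<lambda>u. \<bar>u\<bar> powr (p + 1) / (p + 1)) has_real_derivative sgn u * \<bar>u\<bar> powr p) (at u)"
      using pos by simp
  next
    case less
    then show "((\<lambda>u. \<bar>u\<bar> powr (p + 1) / (p + 1)) has_real_derivative sgn u * \<bar>u\<bar> powr p) (at u)"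
      using pos[of "- u"] by (simp add: DERIV_mirror)
  qed
qed

text \<open>Separation of variables, done by monotonicity instead of integration: while
  \<open>V\<close> is positive, \<open>V powr (1 - \<theta>)\<close> has slope at most
  \<open>- K * (1 - \<theta>)\<close>. The derivative is one-sided at time 0.\<close>

lemma finite_time_extinction:
  fixes V V' :: "real \<Rightarrow> real" and K \<theta> :: real
  assumes V: "\<And>t. 0 \<le> t \<Longrightarrow> (V has_real_derivative V' t) (at t within {0..})"
    and nonneg: "\<And>t. 0 \<le> t \<Longrightarrow> 0 \<le> V t"
    and decay: "\<And>t. 0 \<le> t \<Longrightarrow> V' t \<le> - K * V t powr \<theta>"
    and "0 < K" "\<theta> < 1"
  shows "\<exists>T\<ge>0. \<forall>t\<ge>T. V t = 0"
proof -
  \<comment> \<open>Kept general in \<open>f\<close> because it serves both \<open>V\<close> and its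
    power plus a linear term.\<close>
  have nonincreasing: "f t \<le> f s"
    if "0 \<le> s" "s \<le> t" "\<And>u. u \<in> {s..t} \<Longrightarrow> (f has_real_derivative f' u) (at u within {0..})"
      "\<And>u. u \<in> {s..t} \<Longrightarrow> f' u \<le> 0" for f f' :: "real \<Rightarrow> real" and s t
  proof (rule DERIV_nonpos_imp_decreasing_open[OF \<open>s \<le> t\<close>])
    show "continuous_on {s..t} f"
    proof (rule DERIV_continuous_on)
      show "(f has_real_derivative f' u) (at u within {s..t})" if "u \<in> {s..t}" for u
        by (rule DERIV_subset[OF \<open>\<And>u. u \<in> {s..t} \<Longrightarrow> (f has_real_derivative f' u) (at u within {0..})\<close>[OF that]])
           (use \<open>0 \<le> s\<close> in auto)
    qed
    fix u assume u: "s < u" "u < t"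
    then have "at u within {0..} = at u"
      using \<open>0 \<le> s\<close> by (intro at_within_interior) auto
    then show "\<exists>y. (f has_real_derivative y) (at u) \<and> y \<le> 0"
      using that(3)[of u] that(4)[of u] u by auto
  qed
  \<comment> \<open>The zero of the line
    \<open>V 0 powr (1 - \<theta>) - K * (1 - \<theta>) * t\<close>.\<close>
  define T where "T = V 0 powr (1 - \<theta>) / (K * (1 - \<theta>))"
  have T: "0 \<le> T"
    using assms by (simp add: T_def)
  have "V t = 0" if "T \<le> t" for t
  proof (rule ccontr)
    have t: "0 \<le> t"
      using T that by simp
    assume "V t \<noteq> 0"
    then have "0 < V t"
      using nonneg[OF t] by simp
    \<comment> \<open>The power is differentiated only at positive values, so positivity at
      \<open>t\<close> is carried back to all of \<open>{0..t}\<close> by monotonicity.\<close>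
    have pos: "0 < V s" if "s \<in> {0..t}" for s
    proof -
      have "V t \<le> V s"
      proof (rule nonincreasing[where f = V and f' = V'])
        fix u assume "u \<in> {s..t}"
        with \<open>s \<in> {0..t}\<close> have "0 \<le> u" by simp
        with decay[of u] \<open>0 < K\<close> show "V' u \<le> 0"
          by (smt (verit) mult_nonneg_nonneg mult_minus_left powr_ge_zero)
      qed (use that V in auto)
      with \<open>0 < V t\<close> show ?thesis by simp
    qed
    \<comment> \<open>The integrated inequality; the term with \<open>* 0\<close> keeps the right
      side in the form \<open>f 0\<close>.\<close>
    have "V t powr (1 - \<theta>) + K * (1 - \<theta>) * t \<le> V 0 powr (1 - \<theta>) + K * (1 - \<theta>) * 0"
    proof (rule nonincreasing[where f = "\<lambda>s. V s powr (1 - \<theta>) + K * (1 - \<theta>) * s"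
          and f' = "\<lambda>u. (1 - \<theta>) * (V u powr (- \<theta>) * V' u + K)"])
      fix u assume u: "u \<in> {0..t}"
      have "((\<lambda>s. V s powr (1 - \<theta>)) has_real_derivative (1 - \<theta>) * V u powr (1 - \<theta> - 1) * V' u) (at u within {0..})"
        by (rule DERIV_chain2[OF has_real_derivative_powr[OF pos[OF u]] V]) (use u in simp)
      from DERIV_add[OF this DERIV_cmult[OF DERIV_ident, of "K * (1 - \<theta>)"]]
      show "((\<lambda>s. V s powr (1 - \<theta>) + K * (1 - \<theta>) * s) has_real_derivative
          (1 - \<theta>) * (V u powr (- \<theta>) * V' u + K)) (at u within {0..})"
        by (simp add: algebra_simps)
      have "V u powr (- \<theta>) * V' u \<le> V u powr (- \<theta>) * (- K * V u powr \<theta>)"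
        using decay[of u] u by (intro mult_left_mono) auto
      also have "\<dots> = - K"
        using pos[OF u] by (simp add: powr_minus field_simps)
      finally show "(1 - \<theta>) * (V u powr (- \<theta>) * V' u + K) \<le> 0"
        using \<open>\<theta> < 1\<close> by (intro mult_nonneg_nonpos) auto
    qed (use t in auto)
    moreover have "V 0 powr (1 - \<theta>) \<le> K * (1 - \<theta>) * t"
      using that assms(4,5) by (simp add: T_def field_simps)
    moreover have "0 < V t powr (1 - \<theta>)"
      using \<open>0 < V t\<close> by simp
    ultimately show False by simp
  qed
  with T show ?thesis by blast
qed

section \<open>Gradient of the loss and backpropagation\<close>

text \<open>For \<open>\<alpha> > 0\<close>, the partial derivative of the loss in output
  \<open>r\<close>; it vanishes at the target.\<close>

definition loss_grad :: "real \<Rightarrow> (nat \<Rightarrow> real) \<Rightarrow> (nat \<Rightarrow> real) \<Rightarrow> nat \<Rightarrow> real" where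
  "loss_grad \<alpha> ystar y r = sgn (y r - ystar r) * \<bar>y r - ystar r\<bar> powr \<alpha>"

lemma loss_has_real_derivative:
  assumes "0 < \<alpha>"
    and "\<And>r. r \<in> {1..m} \<Longrightarrow> ((\<lambda>s. y s r) has_real_derivative y' r) (at t within S)"
  shows "((\<lambda>s. loss \<alpha> m ystar (y s)) has_real_derivative
           (\<Sum>r=1..m. loss_grad \<alpha> ystar (y t) r * y' r)) (at t within S)"
  unfolding loss_def loss_grad_def
proof (rule DERIV_sum)
  fix r assume "r \<in> {1..m}"
  then have "((\<lambda>s. y s r - ystar r) has_real_derivative y' r) (at t within S)"
    using assms(2) by (auto intro!: derivative_eq_intros)
  from DERIV_chain2[OF abs_powr_has_real_derivative[OF \<open>0 < \<alpha>\<close>] this]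
  show "((\<lambda>s. \<bar>y s r - ystar r\<bar> powr (\<alpha> + 1) / (\<alpha> + 1)) has_real_derivative
      sgn (y t r - ystar r) * \<bar>y t r - ystar r\<bar> powr \<alpha> * y' r) (at t within S)" .
qed

lemma loss_nonneg: "0 \<le> loss \<alpha> m ystar y" if "0 < \<alpha>"
  using that unfolding loss_def by (intro sum_nonneg) auto

text \<open>\<open>feed\<close> recurses on the last layer, \<open>backprop\<close> on the first;
  this reconciles the two recursions.\<close>

lemma feed_Suc_front:
  "feed \<sigma> b d W l (Suc r) z = feed \<sigma> b d W (Suc l) r (unit_out \<sigma> b (lin d W l z))"
  by (induction r) simp_all

text \<open>The gradient of the loss in the outputs \<open>z\<close> of layer \<open>l\<close>, computed by backpropagation
  through the remaining \<open>r\<close> layers.\<close>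

primrec backprop :: "(real \<Rightarrow> real) \<Rightarrow> real \<Rightarrow> (nat \<Rightarrow> nat) \<Rightarrow> real \<Rightarrow> (nat \<Rightarrow> real) \<Rightarrow> weights
    \<Rightarrow> nat \<Rightarrow> nat \<Rightarrow> (nat \<Rightarrow> real) \<Rightarrow> nat \<Rightarrow> real" where
  "backprop \<sigma> b d \<alpha> ystar W 0 l z i = loss_grad \<alpha> ystar z i"
| "backprop \<sigma> b d \<alpha> ystar W (Suc r) l z i =
     (\<Sum>j=1..d (Suc l). deriv \<sigma> (lin d W l z j)
        * backprop \<sigma> b d \<alpha> ystar W r (Suc l) (unit_out \<sigma> b (lin d W l z)) j * W l j i)"

text \<open>One chain rule for two uses: fixed weights with varying \<open>z\<close> give the
  sensitivities, fixed \<open>z\<close> with varying weights gives the derivative during training.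
  The induction peels off the first layer, whose outputs become the new \<open>z\<close>. The bias
  entry is constant, hence \<open>z' 0 = 0\<close>.\<close>

lemma loss_feed_has_real_derivative:
  assumes "0 < \<alpha>" and \<sigma>: "\<And>u. \<sigma> differentiable (at u)"
    and "\<And>q j i. q < r \<Longrightarrow> j \<in> {1..d (Suc (l + q))} \<Longrightarrow> i \<in> {0..d (l + q)} \<Longrightarrow>
      ((\<lambda>s. W s (l + q) j i) has_real_derivative W' (l + q) j i) (at t within S)"
    and "\<And>i. i \<in> {0..d l} \<Longrightarrow> ((\<lambda>s. z s i) has_real_derivative z' i) (at t within S)"
    and "z' 0 = 0"
  shows "((\<lambda>s. loss \<alpha> (d (l + r)) ystar (feed \<sigma> b d (W s) l r (z s))) has_real_derivative
      (\<Sum>i=1..d l. backprop \<sigma> b d \<alpha> ystar (W t) r l (z t) i * z' i)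
      + (\<Sum>q<r. \<Sum>j=1..d (Suc (l + q)). \<Sum>i=0..d (l + q).
          deriv \<sigma> (lin d (W t) (l + q) (feed \<sigma> b d (W t) l q (z t)) j)
          * backprop \<sigma> b d \<alpha> ystar (W t) (r - Suc q) (Suc (l + q)) (feed \<sigma> b d (W t) l (Suc q) (z t)) j
          * feed \<sigma> b d (W t) l q (z t) i * W' (l + q) j i)) (at t within S)"
  using assms(3-)
proof (induction r arbitrary: l z z')
  case 0
  then show ?case
    using loss_has_real_derivative[OF \<open>0 < \<alpha>\<close>, of "d l" z z'] by simp
next
  case (Suc r)
  define A where "A s = lin d (W s) l (z s)" for s
  define A' where "A' j = (\<Sum>i=0..d l. W' l j i * z t i + z' i * W t l j i)" for j
  define B where "B = backprop \<sigma> b d \<alpha> ystar (W t) r (Suc l) (unit_out \<sigma> b (A t))"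
  have A: "((\<lambda>s. A s j) has_real_derivative A' j) (at t within S)" if "j \<in> {1..d (Suc l)}" for j
    unfolding A_def A'_def lin_def using Suc.prems(1)[of 0 j] Suc.prems(2) that
    by (intro DERIV_sum DERIV_mult) auto
  have \<sigma>': "(\<sigma> has_real_derivative deriv \<sigma> u) (at u)" for u
    using \<sigma>[of u] by (simp add: DERIV_deriv_iff_real_differentiable)
  have z: "((\<lambda>s. unit_out \<sigma> b (A s) j) has_real_derivative (if j = 0 then 0 else deriv \<sigma> (A t j) * A' j))
      (at t within S)" if "j \<in> {0..d (Suc l)}" for j
    using that DERIV_chain2[OF \<sigma>' A[of j]] by (auto simp: unit_out_def)
  have W: "((\<lambda>s. W s (Suc l + q) j i) has_real_derivative W' (Suc l + q) j i) (at t within S)"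
    if "q < r" "j \<in> {1..d (Suc (Suc l + q))}" "i \<in> {0..d (Suc l + q)}" for q j i
    using Suc.prems(1)[of "Suc q" j i] that by simp
  \<comment> \<open>The product rule in \<open>A'\<close> splits the sum: the first half becomes the
    gradient in \<open>z\<close>, the second is the summand \<open>q = 0\<close> of the weight part.
    The induction hypothesis at \<open>Suc l\<close> supplies the summands with larger
    \<open>q\<close>.\<close>
  have "(\<Sum>j=1..d (Suc l). B j * (if j = 0 then 0 else deriv \<sigma> (A t j) * A' j))
      = (\<Sum>j=1..d (Suc l). \<Sum>i=0..d l. deriv \<sigma> (A t j) * B j * W t l j i * z' i)
        + (\<Sum>j=1..d (Suc l). \<Sum>i=0..d l. deriv \<sigma> (A t j) * B j * z t i * W' l j i)"
    by (simp add: A'_def sum.distrib[symmetric] sum_distrib_left algebra_simps cong: sum.cong_simp)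
  also have "(\<Sum>j=1..d (Suc l). \<Sum>i=0..d l. deriv \<sigma> (A t j) * B j * W t l j i * z' i)
      = (\<Sum>i=1..d l. backprop \<sigma> b d \<alpha> ystar (W t) (Suc r) l (z t) i * z' i)"
    by (subst sum.swap)
       (simp add: sum.atLeast_Suc_atMost \<open>z' 0 = 0\<close> A_def B_def sum_distrib_right)
  finally show ?case
    using Suc.IH[of "Suc l" "\<lambda>s. unit_out \<sigma> b (A s)", OF W z]
    by (simp only: sum.lessThan_Suc_shift feed_Suc_front A_def[symmetric] B_def[symmetric] o_def)
       (simp add: A_def B_def feed_Suc_front add.assoc del: feed.simps(2) backprop.simps(2))
qed


lemma layer_out_Suc: "layer_out \<sigma> b d x W (Suc l) = unit_out \<sigma> b (preact \<sigma> b d x W l)"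
  by (simp add: layer_out_def preact_def)

text \<open>Varying one activation with all weights fixed moves a single output of that layer, so
  the gradient sum collapses to its term \<open>j\<close>. As \<open>j\<close> is at least 1, the
  bias unit does not move.\<close>

lemma sensitivity_eq_backprop:
  assumes "0 < \<alpha>" and \<sigma>: "\<And>u. \<sigma> differentiable (at u)" and "l < N" "j \<in> {1..d (Suc l)}"
  shows "sensitivity \<sigma> b d N \<alpha> ystar x W l j = deriv \<sigma> (preact \<sigma> b d x W l j)
    * backprop \<sigma> b d \<alpha> ystar W (N - Suc l) (Suc l) (layer_out \<sigma> b d x W (Suc l)) j"
proof -
  define P where "P = preact \<sigma> b d x W l"
  define z' where "z' i = (if i = j then deriv \<sigma> (P j) else 0)" for i
  have "((\<lambda>s. unit_out \<sigma> b (P(j := s)) i) has_real_derivative z' i) (at (P j))" for i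
    using \<sigma>[of "P j"] \<open>j \<in> _\<close>
    by (cases "i = 0"; cases "i = j")
       (simp_all add: unit_out_def z'_def DERIV_deriv_iff_real_differentiable)
  then have "((\<lambda>s. loss \<alpha> (d (Suc l + (N - Suc l))) ystar
        (feed \<sigma> b d W (Suc l) (N - Suc l) (unit_out \<sigma> b (P(j := s))))) has_real_derivative
      (\<Sum>i=1..d (Suc l). backprop \<sigma> b d \<alpha> ystar W (N - Suc l) (Suc l) (unit_out \<sigma> b P) i * z' i)) (at (P j))"
    using loss_feed_has_real_derivative[OF \<open>0 < \<alpha>\<close> \<sigma>, where W = "\<lambda>_. W" and W' = "\<lambda>_ _ _. 0"
        and z = "\<lambda>s. unit_out \<sigma> b (P(j := s))" and z' = z' and t = "P j" and S = UNIV
        and l = "Suc l" and r = "N - Suc l" and d = d and b = b and ystar = ystar] \<open>j \<in> _\<close>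
    by (simp add: z'_def)
  moreover have "(\<Sum>i=1..d (Suc l). backprop \<sigma> b d \<alpha> ystar W (N - Suc l) (Suc l) (unit_out \<sigma> b P) i * z' i)
      = deriv \<sigma> (P j) * backprop \<sigma> b d \<alpha> ystar W (N - Suc l) (Suc l) (unit_out \<sigma> b P) j"
    using \<open>j \<in> _\<close> by (simp add: z'_def if_distrib[of "\<lambda>x. _ * x"] sum.delta' cong: if_cong)
  ultimately show ?thesis
    using \<open>l < N\<close> by (simp add: sensitivity_def P_def[symmetric] layer_out_Suc DERIV_imp_deriv)
qed

text \<open>The rule that the partial derivative of \<open>E\<close> in a weight is
  \<open>\<delta>\<close> times \<open>z\<close>, in the form needed along a trajectory; the input
  is constant in time and contributes nothing.\<close>

lemma loss_layer_out_has_real_derivative: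
  assumes "0 < \<alpha>" and \<sigma>: "\<And>u. \<sigma> differentiable (at u)"
    and W: "\<And>l j i. l < N \<Longrightarrow> j \<in> {1..d (Suc l)} \<Longrightarrow> i \<in> {0..d l} \<Longrightarrow>
      ((\<lambda>s. W s l j i) has_real_derivative W' l j i) (at t within S)"
  shows "((\<lambda>s. loss \<alpha> (d N) ystar (layer_out \<sigma> b d x (W s) N)) has_real_derivative
      (\<Sum>l<N. \<Sum>j=1..d (Suc l). \<Sum>i=0..d l. sensitivity \<sigma> b d N \<alpha> ystar x (W t) l j
          * layer_out \<sigma> b d x (W t) l i * W' l j i)) (at t within S)"
proof -
  have "((\<lambda>s. loss \<alpha> (d N) ystar (layer_out \<sigma> b d x (W s) N)) has_real_derivative
      (\<Sum>q<N. \<Sum>j=1..d (Suc q). \<Sum>i=0..d q. deriv \<sigma> (preact \<sigma> b d x (W t) q j)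
          * backprop \<sigma> b d \<alpha> ystar (W t) (N - Suc q) (Suc q) (layer_out \<sigma> b d x (W t) (Suc q)) j
          * layer_out \<sigma> b d x (W t) q i * W' q j i)) (at t within S)"
    using loss_feed_has_real_derivative[OF \<open>0 < \<alpha>\<close> \<sigma>, where W = W and W' = W'
        and z = "\<lambda>_. x(0 := b)" and z' = "\<lambda>_. 0" and t = t and S = S and l = 0 and r = N and d = d
        and b = b and ystar = ystar] W
    by (simp add: layer_out_def preact_def del: feed.simps)
  then show ?thesis
    using sensitivity_eq_backprop[OF \<open>0 < \<alpha>\<close> \<sigma>]
    by (elim DERIV_cong) (intro sum.cong, auto)
qed

section \<open>Lower bounds at the output layer\<close>

lemma finite_pos_lower_bound:
  fixes f :: "'a \<Rightarrow> real"
  assumes "finite A" "\<And>a. a \<in> A \<Longrightarrow> 0 < f a"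
  obtains \<kappa> where "0 < \<kappa>" "\<And>a. a \<in> A \<Longrightarrow> \<kappa> \<le> f a"
proof (rule that)
  \<comment> \<open>The extra element 1 keeps \<open>Min\<close> meaningful when \<open>A\<close> is
    empty.\<close>
  show "0 < Min (insert 1 (f ` A))" "\<And>a. a \<in> A \<Longrightarrow> Min (insert 1 (f ` A)) \<le> f a"
    using assms by auto
qed

text \<open>Some summand is at least the average, and dropping the divisor
  \<open>\<alpha> + 1 > 1\<close> only enlarges it.\<close>

lemma loss_dominant_error:
  assumes "0 < \<alpha>" "0 < m"
  obtains r where "r \<in> {1..m}" "loss \<alpha> m ystar y / m \<le> \<bar>y r - ystar r\<bar> powr (\<alpha> + 1)"
proof -
  have "\<exists>r\<in>{1..m}. loss \<alpha> m ystar y / m \<le> \<bar>y r - ystar r\<bar> powr (\<alpha> + 1) / (\<alpha> + 1)"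
  proof (rule ccontr)
    assume "\<not> ?thesis"
    then have "loss \<alpha> m ystar y < (\<Sum>r=1..m. loss \<alpha> m ystar y / m)"
      unfolding loss_def using \<open>0 < m\<close> by (intro sum_strict_mono) (auto simp: not_le)
    then show False
      using \<open>0 < m\<close> by simp
  qed
  moreover have "\<bar>u\<bar> powr (\<alpha> + 1) / (\<alpha> + 1) \<le> \<bar>u\<bar> powr (\<alpha> + 1)" for u :: real
    using \<open>0 < \<alpha>\<close> by (simp add: divide_le_eq mult_left_le algebra_simps)
  ultimately show ?thesis
    using that by (meson order_trans)
qed

text \<open>No layer remains to be backpropagated through, so the sensitivity is the slope of
  \<open>\<sigma>\<close> times \<open>loss_grad\<close>. At a met target the left side is 0, so the
  bound by \<open>c\<close> is asked for only elsewhere.\<close>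

lemma output_sensitivity_ge:
  assumes "0 < \<alpha>" "\<And>u. \<sigma> differentiable (at u)" "0 < N" "r \<in> {1..d N}"
    and "layer_out \<sigma> b d x W N r \<noteq> ystar r \<Longrightarrow> c \<le> \<bar>deriv \<sigma> (preact \<sigma> b d x W (N - 1) r)\<bar>"
  shows "c * \<bar>layer_out \<sigma> b d x W N r - ystar r\<bar> powr \<alpha>
    \<le> \<bar>sensitivity \<sigma> b d N \<alpha> ystar x W (N - 1) r\<bar>"
proof -
  have "sensitivity \<sigma> b d N \<alpha> ystar x W (N - 1) r
      = deriv \<sigma> (preact \<sigma> b d x W (N - 1) r) * loss_grad \<alpha> ystar (layer_out \<sigma> b d x W N) r"
    using sensitivity_eq_backprop[OF assms(1,2), of "N - 1" N r d] assms(3,4) by simp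
  then show ?thesis
    using assms(5)
    by (cases "layer_out \<sigma> b d x W N r = ystar r")
       (auto simp: loss_grad_def abs_mult abs_sgn_eq intro: mult_right_mono)
qed

section \<open>Finite-time convergence of the outputs\<close>

text \<open>\<open>nondegenerate\<close> prevents the sensitivity of an output that misses its
  target from vanishing through a flat \<open>\<sigma>\<close>. \<open>nonzero\<close> asks for a
  genuine unit \<open>p\<close>, not the bias unit, and \<open>p\<close> may change with
  time.\<close>

theorem theorem2:
  fixes \<sigma> :: "real \<Rightarrow> real" and b :: real
    and N n m :: nat and d :: "nat \<Rightarrow> nat"
    and x ystar :: "nat \<Rightarrow> real"
    and a \<alpha> \<beta> \<gamma> c :: real
    and k :: "nat \<Rightarrow> nat \<Rightarrow> nat \<Rightarrow> real"
    and w :: "real \<Rightarrow> weights"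
  assumes depth: "N \<ge> 1" and widths: "d 0 = n" "d N = m"
    and activation: "\<And>u. \<sigma> differentiable (at u)" "\<not> linear \<sigma>"
    and input: "0 < a" "\<And>i. i \<in> {1..n} \<Longrightarrow> \<bar>x i\<bar> < a"
    and exponents: "0 < \<alpha>" "\<alpha> < 1" "0 < \<beta>" "\<beta> < 1" "\<alpha> + \<beta> < 1"
    and gains: "\<And>l j i. l < N \<Longrightarrow> j \<in> {1..d (Suc l)} \<Longrightarrow> i \<in> {0..d l} \<Longrightarrow> 0 < k l j i"
    and nonzero: "0 < \<gamma>"
      "\<And>t l. 0 \<le> t \<Longrightarrow> l < N \<Longrightarrow> \<exists>p\<in>{1..d l}. \<gamma> < \<bar>layer_out \<sigma> b d x (w t) l p\<bar>"
    and nondegenerate: "0 < c"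
      "\<And>t r. 0 \<le> t \<Longrightarrow> r \<in> {1..m} \<Longrightarrow> layer_out \<sigma> b d x (w t) N r \<noteq> ystar r \<Longrightarrow>
         c \<le> \<bar>deriv \<sigma> (preact \<sigma> b d x (w t) (N - 1) r)\<bar>"
    and update: "\<And>t l j i. 0 \<le> t \<Longrightarrow> l < N \<Longrightarrow> j \<in> {1..d (Suc l)} \<Longrightarrow> i \<in> {0..d l} \<Longrightarrow>
      ((\<lambda>s. w s l j i) has_real_derivative
         - k l j i
         * sgn (sensitivity \<sigma> b d N \<alpha> ystar x (w t) l j * layer_out \<sigma> b d x (w t) l i)
         * \<bar>sensitivity \<sigma> b d N \<alpha> ystar x (w t) l j * layer_out \<sigma> b d x (w t) l i\<bar> powr \<alpha>
         * loss \<alpha> m ystar (layer_out \<sigma> b d x (w t) N) powr \<beta>) (at t within {0..})"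
  shows "\<exists>T\<ge>0. \<forall>t\<ge>T. \<forall>r\<in>{1..m}. layer_out \<sigma> b d x (w t) N r = ystar r"
proof (cases "m = 0")
  case True
  then show ?thesis by auto
next
  case False
  define z where "z t = layer_out \<sigma> b d x (w t)" for t
  define \<delta> where "\<delta> t = sensitivity \<sigma> b d N \<alpha> ystar x (w t)" for t
  define E where "E t = loss \<alpha> m ystar (z t N)" for t
  \<comment> \<open>The decay of \<open>E\<close> due to one weight: with \<open>u\<close> for
    \<open>\<delta>\<close> times \<open>z\<close>, the identity
    \<open>u * sgn u = \<bar>u\<bar>\<close> raises the exponent \<open>\<alpha>\<close> of the
    update to \<open>\<alpha> + 1\<close>.\<close>
  define D where "D t l j i = k l j i * \<bar>\<delta> t l j * z t l i\<bar> powr (\<alpha> + 1) * E t powr \<beta>" for t l j i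
  have E_deriv: "(E has_real_derivative - (\<Sum>l<N. \<Sum>j=1..d (Suc l). \<Sum>i=0..d l. D t l j i)) (at t within {0..})"
    if "0 \<le> t" for t
  proof -
    have "\<delta> t l j * z t l i * (- k l j i * sgn (\<delta> t l j * z t l i) * \<bar>\<delta> t l j * z t l i\<bar> powr \<alpha> * E t powr \<beta>)
        = - D t l j i" for l j i
    proof -
      have "u * (- q * sgn u * \<bar>u\<bar> powr \<alpha> * e) = - (q * \<bar>u\<bar> powr (\<alpha> + 1) * e)" for u q e :: real
        by (cases "u = 0") (auto simp: powr_add sgn_if)
      then show ?thesis by (simp only: D_def)
    qed
    moreover have "(E has_real_derivative (\<Sum>l<N. \<Sum>j=1..d (Suc l). \<Sum>i=0..d l. \<delta> t l j * z t l i *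
        (- k l j i * sgn (\<delta> t l j * z t l i) * \<bar>\<delta> t l j * z t l i\<bar> powr \<alpha> * E t powr \<beta>)))
        (at t within {0..})"
      unfolding E_def[abs_def] z_def \<delta>_def widths(2)[symmetric]
      by (rule loss_layer_out_has_real_derivative[OF \<open>0 < \<alpha>\<close> activation(1)])
         (rule update[OF that, folded widths(2)])
    ultimately show ?thesis
      by (simp only: sum_negf)
  qed
  have E_nonneg: "0 \<le> E t" for t
    using loss_nonneg[OF \<open>0 < \<alpha>\<close>] by (simp add: E_def)
  \<comment> \<open>The gains into the output layer are finitely many and constant in time, so one
    positive bound serves for all \<open>t\<close>.\<close>
  obtain \<kappa> where \<kappa>: "0 < \<kappa>" "\<And>j i. j \<in> {1..m} \<Longrightarrow> i \<in> {0..d (N - 1)} \<Longrightarrow> \<kappa> \<le> k (N - 1) j i"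
  proof (rule finite_pos_lower_bound[of "{1..m} \<times> {0..d (N - 1)}" "\<lambda>(j, i). k (N - 1) j i"])
    show "0 < (case a of (j, i) \<Rightarrow> k (N - 1) j i)" if "a \<in> {1..m} \<times> {0..d (N - 1)}" for a
      using that gains[of "N - 1"] depth widths by auto
  qed auto
  \<comment> \<open>\<open>\<kappa>\<close> bounds the gain, \<open>c * \<gamma>\<close> comes from
    the slope and the nonzero input, and \<open>m powr \<alpha>\<close> from averaging the loss.
    None depends on \<open>t\<close>, although \<open>p\<close> and \<open>r\<close> below
    do.\<close>
  define K where "K = \<kappa> * (c * \<gamma>) powr (\<alpha> + 1) / m powr \<alpha>"
  have decay: "- (\<Sum>l<N. \<Sum>j=1..d (Suc l). \<Sum>i=0..d l. D t l j i) \<le> - K * E t powr (\<alpha> + \<beta>)"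
    if t: "0 \<le> t" for t
  proof -
    have D_nonneg: "0 \<le> D t l j i" if "l < N" "j \<in> {1..d (Suc l)}" "i \<in> {0..d l}" for l j i
      using gains[OF that] by (simp add: D_def)
    obtain p where p: "p \<in> {1..d (N - 1)}" "\<gamma> < \<bar>z t (N - 1) p\<bar>"
      using nonzero(2)[OF t, of "N - 1"] depth by (auto simp: z_def)
    obtain r where r: "r \<in> {1..m}" "E t / m \<le> \<bar>z t N r - ystar r\<bar> powr (\<alpha> + 1)"
      using loss_dominant_error[of \<alpha> m] \<open>0 < \<alpha>\<close> \<open>m \<noteq> 0\<close> unfolding E_def by blast
    define e where "e = \<bar>z t N r - ystar r\<bar>"
    have "c * e powr \<alpha> \<le> \<bar>\<delta> t (N - 1) r\<bar>"
      unfolding e_def z_def \<delta>_def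
      using output_sensitivity_ge[OF \<open>0 < \<alpha>\<close> activation(1), of N r d b x "w t" ystar c]
        nondegenerate(2)[OF t r(1)] depth widths r(1) by auto
    then have "c * e powr \<alpha> * \<gamma> \<le> \<bar>\<delta> t (N - 1) r * z t (N - 1) p\<bar>"
      unfolding abs_mult using p nonzero(1) by (intro mult_mono) auto
    then have "(c * e powr \<alpha> * \<gamma>) powr (\<alpha> + 1) \<le> \<bar>\<delta> t (N - 1) r * z t (N - 1) p\<bar> powr (\<alpha> + 1)"
      using \<open>0 < \<alpha>\<close> \<open>0 < c\<close> \<open>0 < \<gamma>\<close> by (intro powr_mono2) auto
    \<comment> \<open>Swapping the exponents \<open>\<alpha>\<close> and \<open>\<alpha> + 1\<close>
      on \<open>e\<close> produces the power that dominates \<open>E t / m\<close>.\<close>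
    moreover have "(c * e powr \<alpha> * \<gamma>) powr (\<alpha> + 1) = (c * \<gamma>) powr (\<alpha> + 1) * (e powr (\<alpha> + 1)) powr \<alpha>"
      using \<open>0 < c\<close> \<open>0 < \<gamma>\<close> by (simp add: powr_mult powr_powr mult_ac)
    moreover have "(E t / m) powr \<alpha> \<le> (e powr (\<alpha> + 1)) powr \<alpha>"
      using r(2) E_nonneg \<open>0 < \<alpha>\<close> by (intro powr_mono2) (auto simp: e_def)
    ultimately have "(c * \<gamma>) powr (\<alpha> + 1) * (E t / m) powr \<alpha>
        \<le> \<bar>\<delta> t (N - 1) r * z t (N - 1) p\<bar> powr (\<alpha> + 1)"
      by (smt (verit) mult_left_mono powr_ge_zero)
    moreover have "\<kappa> \<le> k (N - 1) r p"
      using \<kappa>(2) p(1) r(1) by simp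
    ultimately have "\<kappa> * ((c * \<gamma>) powr (\<alpha> + 1) * (E t / m) powr \<alpha>) * E t powr \<beta> \<le> D t (N - 1) r p"
      unfolding D_def using \<kappa>(1) by (intro mult_mono) auto
    then have "K * E t powr (\<alpha> + \<beta>) \<le> D t (N - 1) r p"
      using E_nonneg[of t] by (simp add: K_def powr_divide powr_add mult_ac)
    also have "\<dots> \<le> (\<Sum>i=0..d (N - 1). D t (N - 1) r i)"
      using p r(1) depth widths by (intro member_le_sum D_nonneg) auto
    also have "\<dots> \<le> (\<Sum>j=1..d (Suc (N - 1)). \<Sum>i=0..d (N - 1). D t (N - 1) j i)"
      using r(1) depth widths
      by (intro member_le_sum[where f = "\<lambda>j. \<Sum>i=0..d (N - 1). D t (N - 1) j i"] sum_nonneg D_nonneg) auto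
    also have "\<dots> \<le> (\<Sum>l<N. \<Sum>j=1..d (Suc l). \<Sum>i=0..d l. D t l j i)"
      using depth
      by (intro member_le_sum[where f = "\<lambda>l. \<Sum>j=1..d (Suc l). \<Sum>i=0..d l. D t l j i"] sum_nonneg D_nonneg) auto
    finally show ?thesis by simp
  qed
  have "0 < K"
    using \<kappa>(1) \<open>0 < c\<close> \<open>0 < \<gamma>\<close> \<open>m \<noteq> 0\<close> by (simp add: K_def)
  then obtain T where T: "0 \<le> T" "\<And>t. T \<le> t \<Longrightarrow> E t = 0"
    using finite_time_extinction[OF E_deriv E_nonneg decay] exponents(5) by blast
  have "z t N r = ystar r" if "T \<le> t" "r \<in> {1..m}" for t r
    using T(2)[OF that(1)] that(2) \<open>0 < \<alpha>\<close>
    by (auto simp: E_def loss_def sum_nonneg_eq_0_iff)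
  with T(1) show ?thesis
    unfolding z_def by blast
qed

end
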